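(* Let $\gamma\in[0,2)$, $d=\frac{2(\gamma+1)}{2-\gamma}$ and $n\ge2d=\frac{4(\gamma+1)}{2-\gamma}\ge2$. Consider the anti-tree over $(X,m)$, $m=1$, with root $o$ and sphere function $s_{k-1}=[k^\gamma]$, $k\ge1$, with intrinsic degree metric $\rho$, and its associated one-dimensional graph $\tilde b$ over $(\mathbb N_0,\tilde m)$ with intrinsic degree metric $\tilde\rho$. Then, for all $x\in X$ and $r\ge1\vee\rho(o,x)$, $$\tilde h_{\tilde B_r(|x|),n}\asymp\frac{\tilde m(\tilde B_r(|x|))^{\frac2n}}{r},$$ with implied constants independent of $x$ and $r$.
   Context: $f\asymp g$ means that there is a constant $C>0$ with $C^{-1}f\le g\le Cf$; $a\vee b$, $a\wedge b$ denote maximum and minimum. Anti-tree: $[\cdot]$ denotes the integer part. $X=\bigcup_{k\ge0}S_k$ is a disjoint union with $\#S_k=s_k$, where $s_{k-1}=[k^\gamma]$ for $k\ge1$ (so $S_0=\{o\}$); $b(x,y)=b(y,x)=1$ whenever $x\in S_k$, $y\in S_{k+1}$ for some $k\ge0$ and $b(x,y)=0$ otherwise. $m=1$ is the counting measure; $|x|=k$ for $x\in S_k$ (the combinatorial distance to $o$). Associated one-dimensional graph: on $\tilde X=\mathbb N_0$, $\tilde m(k)=s_k$, $\tilde b(k,k+1)=\tilde b(k+1,k)=s_ks_{k+1}$ for $k\ge0$ and $\tilde b(k,l)=0$ otherwise; $\tilde m(A)=\sum_{k\in A}\tilde m(k)$. Intrinsic degree metric of a graph $b$ over $(X,m)$: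 with $\operatorname{Deg}(x)=\frac1{m(x)}\sum_yb(x,y)$, $\rho(x,y)=\inf\sum_{j=0}^{k-1}\left(\frac1{\operatorname{Deg}(x_j)}\wedge\frac1{\operatorname{Deg}(x_{j+1})}\right)^{1/2}$, the infimum being over all paths $x=x_0\sim\dots\sim x_k=y$ of consecutive neighbors; $\tilde\rho$ is the same for $\tilde b$ over $(\mathbb N_0,\tilde m)$. Balls: $\tilde B_r(k)=\{l\in\mathbb N_0:\tilde\rho(k,l)\le r\}$. Isoperimetric constant: for finite $B\subseteq\mathbb N_0$, $$\tilde h_{B,n}=\inf_{\emptyset\ne W\subseteq B}\frac{\tilde b\tilde\rho(\partial W)}{\tilde m(W)^{\frac{n-2}n}},\qquad\partial W=\{(k,l)\in(W\times(\mathbb N_0\setminus W))\cup((\mathbb N_0\setminus W)\times W):\tilde b(k,l)>0\},$$ with $\tilde b\tilde\rho(\partial W)=\sum_{(k,l)\in\partial W}\tilde b(k,l)\tilde\rho(k,l)$. *)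

theory Defs
  imports "HOL-Analysis.Infinite_Sum" "HOL-Library.Disjoint_Sets"
begin

text \<open>
  A weighted graph over \<open>(X, m)\<close> is given by a carrier \<open>X\<close>, a symmetric weight \<open>b\<close> (with
  \<open>x \<sim> y\<close> iff \<open>b x y > 0\<close>) and a vertex measure \<open>m\<close>.
\<close>

definition vertex_measure :: "('a \<Rightarrow> real) \<Rightarrow> 'a set \<Rightarrow> real" where
  "vertex_measure m A = (\<Sum>\<^sub>\<infinity>x\<in>A. m x)"

definition weighted_degree ::
    "'a set \<Rightarrow> ('a \<Rightarrow> 'a \<Rightarrow> real) \<Rightarrow> ('a \<Rightarrow> real) \<Rightarrow> 'a \<Rightarrow> real" where
  "weighted_degree X b m x = 1 / m x * (\<Sum>\<^sub>\<infinity>y\<in>X. b x y)"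

definition graph_paths :: "'a set \<Rightarrow> ('a \<Rightarrow> 'a \<Rightarrow> real) \<Rightarrow> 'a \<Rightarrow> 'a \<Rightarrow> 'a list set" where
  "graph_paths X b x y =
     {p. p \<noteq> [] \<and> hd p = x \<and> last p = y \<and> set p \<subseteq> X \<and> successively (\<lambda>u v. b u v > 0) p}"

definition path_weight ::
    "'a set \<Rightarrow> ('a \<Rightarrow> 'a \<Rightarrow> real) \<Rightarrow> ('a \<Rightarrow> real) \<Rightarrow> 'a list \<Rightarrow> real" where
  "path_weight X b m p =
     (\<Sum>j<length p - 1. sqrt (min (1 / weighted_degree X b m (p ! j))
                                   (1 / weighted_degree X b m (p ! Suc j))))"

text \<open>
  The infimum is taken in the reals, so the value is only meaningful for connected graphs (such as
  anti-trees and their one-dimensional graphs). The one-vertex path gives distance 0 from a vertex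
  to itself.
\<close>

definition degree_metric ::
    "'a set \<Rightarrow> ('a \<Rightarrow> 'a \<Rightarrow> real) \<Rightarrow> ('a \<Rightarrow> real) \<Rightarrow> 'a \<Rightarrow> 'a \<Rightarrow> real" where
  "degree_metric X b m x y = (INF p \<in> graph_paths X b x y. path_weight X b m p)"

definition degree_ball ::
    "'a set \<Rightarrow> ('a \<Rightarrow> 'a \<Rightarrow> real) \<Rightarrow> ('a \<Rightarrow> real) \<Rightarrow> real \<Rightarrow> 'a \<Rightarrow> 'a set" where
  "degree_ball X b m r x = {y \<in> X. degree_metric X b m x y \<le> r}"

text \<open>Each boundary edge occurs in the boundary with both orientations.\<close>

definition edge_boundary :: "'a set \<Rightarrow> ('a \<Rightarrow> 'a \<Rightarrow> real) \<Rightarrow> 'a set \<Rightarrow> ('a \<times> 'a) set" where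
  "edge_boundary X b W = {(x, y) \<in> W \<times> (X - W) \<union> (X - W) \<times> W. b x y > 0}"

text \<open>Intended for finite, nonempty \<open>B \<subseteq> X\<close> only.\<close>

definition isoperimetric_const ::
    "'a set \<Rightarrow> ('a \<Rightarrow> 'a \<Rightarrow> real) \<Rightarrow> ('a \<Rightarrow> real) \<Rightarrow> real \<Rightarrow> 'a set \<Rightarrow> real" where
  "isoperimetric_const X b m n B =
     (INF W \<in> {W. W \<noteq> {} \<and> W \<subseteq> B}.
        (\<Sum>\<^sub>\<infinity>(x, y)\<in>edge_boundary X b W. b x y * degree_metric X b m x y)
          / vertex_measure m W powr ((n - 2) / n))"

definition antitree :: "(nat \<Rightarrow> nat) \<Rightarrow> (nat \<Rightarrow> 'a set) \<Rightarrow> 'a \<Rightarrow> bool" where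
  "antitree s S rt \<longleftrightarrow>
     disjoint_family S \<and> (\<forall>k. finite (S k) \<and> card (S k) = s k) \<and> S 0 = {rt}"

definition antitree_weight :: "(nat \<Rightarrow> 'a set) \<Rightarrow> 'a \<Rightarrow> 'a \<Rightarrow> real" where
  "antitree_weight S x y =
     (if \<exists>k. x \<in> S k \<and> y \<in> S (k + 1) \<or> y \<in> S k \<and> x \<in> S (k + 1) then 1 else 0)"

definition sphere_index :: "(nat \<Rightarrow> 'a set) \<Rightarrow> 'a \<Rightarrow> nat" where
  "sphere_index S x = (THE k. x \<in> S k)"

definition antitree_metric :: "(nat \<Rightarrow> 'a set) \<Rightarrow> 'a \<Rightarrow> 'a \<Rightarrow> real" where
  "antitree_metric S = degree_metric (\<Union>k. S k) (antitree_weight S) (\<lambda>_. 1)"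

definition line_measure :: "(nat \<Rightarrow> nat) \<Rightarrow> nat \<Rightarrow> real" where
  "line_measure s k = real (s k)"

definition line_weight :: "(nat \<Rightarrow> nat) \<Rightarrow> nat \<Rightarrow> nat \<Rightarrow> real" where
  "line_weight s k l = (if l = k + 1 \<or> k = l + 1 then real (s k) * real (s l) else 0)"

definition line_ball :: "(nat \<Rightarrow> nat) \<Rightarrow> real \<Rightarrow> nat \<Rightarrow> nat set" where
  "line_ball s = degree_ball UNIV (line_weight s) (line_measure s)"

definition line_isoperimetric_const :: "(nat \<Rightarrow> nat) \<Rightarrow> real \<Rightarrow> nat set \<Rightarrow> real" where
  "line_isoperimetric_const s = isoperimetric_const UNIV (line_weight s) (line_measure s)"

text \<open>\<open>s\<^sub>k\<^sub>-\<^sub>1 = [k\<^sup>\<gamma>]\<close> for \<open>k \<ge> 1\<close>, with the index shifted by one.\<close>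

definition power_sphere :: "real \<Rightarrow> nat \<Rightarrow> nat" where
  "power_sphere \<gamma> k = nat \<lfloor>real (k + 1) powr \<gamma>\<rfloor>"

end

theory Submission
  imports Defs
begin

text \<open>
  On the line, the distance of \<open>k\<close> and \<open>l\<close> is \<open>\<bar>P l - P k\<bar>\<close>, where \<open>P k\<close> sums the lengths of the first
  \<open>k\<close> edges. The length of the edge \<open>(k, k + 1)\<close> is comparable to \<open>(k + 1)\<^sup>-\<^sup>\<gamma>\<^sup>/\<^sup>2\<close>, hence \<open>P k\<close> to \<open>k\<^sup>\<beta>\<close>
  with \<open>\<beta> = 1 - \<gamma>/2\<close>. For \<open>r \<ge> \<rho>(o, x) \<ge> P |x|\<close> the ball is therefore an initial segment \<open>{0..M}\<close>
  with \<open>r\<close> comparable to \<open>(M + 1)\<^sup>\<beta>\<close> and volume comparable to \<open>(M + 1)\<^sup>\<gamma>\<^sup>+\<^sup>1\<close>.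
  Testing with the whole ball bounds the isoperimetric constant from above. For the lower bound, a set
  \<open>W\<close> with maximum \<open>k\<close> has the boundary edge \<open>(k, k + 1)\<close> and volume at most \<open>(k + 1)\<^sup>\<gamma>\<^sup>+\<^sup>1\<close>, so its
  isoperimetric ratio is at least a constant times \<open>(k + 1)\<close> to the power \<open>2(\<gamma> + 1)/n - \<beta>\<close>; this
  exponent is nonpositive precisely because \<open>n \<ge> 2d\<close>, so \<open>k = M\<close> is the worst case.
\<close>

section \<open>Path metrics and Lipschitz functions\<close>

lemma path_weight_nonneg:
  assumes "\<And>u v. 0 \<le> b u v" and "\<And>u. 0 \<le> m u"
  shows "0 \<le> path_weight X b m p"
  unfolding path_weight_def weighted_degree_def
  by (intro sum_nonneg) (auto simp: assms infsum_nonneg)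

text \<open>Telescoping along the path: crossing an edge changes \<open>f\<close> by at most the
  length of that edge.\<close>

lemma path_weight_ge_Lipschitz:
  fixes f :: "'a \<Rightarrow> real"
  assumes lip: "\<And>u v. u \<in> X \<Longrightarrow> v \<in> X \<Longrightarrow> b u v > 0 \<Longrightarrow>
      \<bar>f v - f u\<bar> \<le> sqrt (min (1 / weighted_degree X b m u) (1 / weighted_degree X b m v))"
    and p: "p \<in> graph_paths X b x y"
  shows "\<bar>f y - f x\<bar> \<le> path_weight X b m p"
proof -
  let ?N = "length p - 1"
  have ne: "p \<noteq> []" and hd: "hd p = x" and last: "last p = y" and sub: "set p \<subseteq> X"
    and succ: "successively (\<lambda>u v. b u v > 0) p"
    using p by (auto simp: graph_paths_def)
  have "f y - f x = (\<Sum>j<?N. f (p ! Suc j) - f (p ! j))"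
    using ne hd last sum_lessThan_telescope[of "\<lambda>j. f (p ! j)" ?N]
    by (simp add: last_conv_nth hd_conv_nth)
  also have "\<bar>\<dots>\<bar> \<le> (\<Sum>j<?N. \<bar>f (p ! Suc j) - f (p ! j)\<bar>)"
    by (rule sum_abs)
  also have "\<dots> \<le> path_weight X b m p"
    unfolding path_weight_def
  proof (intro sum_mono lip)
    fix j assume "j \<in> {..<?N}"
    then have j: "Suc j < length p" by auto
    then show "p ! j \<in> X" "p ! Suc j \<in> X" using sub by (auto simp: subset_eq)
    show "b (p ! j) (p ! Suc j) > 0" using succ j by (simp add: successively_conv_nth)
  qed
  finally show ?thesis .
qed

text \<open>Test functions give lower bounds for distances. A path has to exist, since an infimum of
  reals over the empty set carries no information.\<close>

lemma degree_metric_ge_Lipschitz: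
  fixes f :: "'a \<Rightarrow> real"
  assumes "\<And>u v. u \<in> X \<Longrightarrow> v \<in> X \<Longrightarrow> b u v > 0 \<Longrightarrow>
      \<bar>f v - f u\<bar> \<le> sqrt (min (1 / weighted_degree X b m u) (1 / weighted_degree X b m v))"
    and "graph_paths X b x y \<noteq> {}"
  shows "\<bar>f y - f x\<bar> \<le> degree_metric X b m x y"
  unfolding degree_metric_def using assms
  by (intro cINF_greatest path_weight_ge_Lipschitz)

lemma degree_metric_le_path_weight:
  assumes "\<And>u v. 0 \<le> b u v" and "\<And>u. 0 \<le> m u" and "p \<in> graph_paths X b x y"
  shows "degree_metric X b m x y \<le> path_weight X b m p"
  unfolding degree_metric_def
  by (rule cINF_lower) (use assms path_weight_nonneg[of b m] in \<open>auto intro!: bdd_belowI2[where m = 0]\<close>)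

section \<open>The one-dimensional graph\<close>

text \<open>The number of neighbours in the anti-tree of a vertex in sphere \<open>k\<close>. The
  same formula is the weighted degree on the line, which is why both graphs have the same edge
  lengths. The case \<open>k = 0\<close> is separate because the truncated \<open>k - 1\<close>
  would make the root its own neighbour.\<close>

definition line_degree :: "(nat \<Rightarrow> nat) \<Rightarrow> nat \<Rightarrow> real" where
  "line_degree s k = (if k = 0 then 0 else real (s (k - 1))) + real (s (k + 1))"

definition line_step :: "(nat \<Rightarrow> nat) \<Rightarrow> nat \<Rightarrow> real" where
  "line_step s k = sqrt (min (1 / line_degree s k) (1 / line_degree s (Suc k)))"

definition line_pos :: "(nat \<Rightarrow> nat) \<Rightarrow> nat \<Rightarrow> real" where
  "line_pos s k = (\<Sum>j<k. line_step s j)"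

lemma line_pos_Suc: "line_pos s (Suc k) = line_pos s k + line_step s k"
  by (simp add: line_pos_def)

lemma line_pos_0 [simp]: "line_pos s 0 = 0"
  by (simp add: line_pos_def)

lemma line_degree_nonneg: "0 \<le> line_degree s k"
  by (simp add: line_degree_def)

lemma line_step_nonneg: "0 \<le> line_step s k"
  by (simp add: line_step_def line_degree_nonneg)

lemma mono_line_pos: "mono (line_pos s)"
  by (intro incseq_SucI) (simp add: line_pos_Suc line_step_nonneg)

lemma line_pos_nonneg: "0 \<le> line_pos s k"
  by (simp add: line_pos_def sum_nonneg line_step_nonneg)

text \<open>The factor \<open>s k\<close> in every edge weight at \<open>k\<close> cancels against
  the measure of \<open>k\<close>.\<close>

lemma weighted_degree_line:
  assumes "s k > 0"
  shows "weighted_degree UNIV (line_weight s) (line_measure s) k = line_degree s k"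
proof -
  let ?A = "if k = 0 then {1} else {k - 1, k + 1}"
  have "(\<Sum>\<^sub>\<infinity>l\<in>UNIV. line_weight s k l) = (\<Sum>\<^sub>\<infinity>l\<in>?A. line_weight s k l)"
    by (rule infsum_cong_neutral) (auto simp: line_weight_def split: if_splits)
  also have "\<dots> = (\<Sum>l\<in>?A. line_weight s k l)"
    by (rule infsum_finite) auto
  also have "\<dots> = real (s k) * line_degree s k"
    by (auto simp: line_weight_def line_degree_def algebra_simps)
  finally show ?thesis
    using assms by (simp add: weighted_degree_def line_measure_def)
qed

text \<open>Monotone paths, ascending here and descending in the next lemma, will be seen to realise
  the distance.\<close>

lemma line_path_up:
  assumes "\<And>k. s k > 0"
  shows "[k..<Suc (k + i)] \<in> graph_paths UNIV (line_weight s) k (k + i)"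
    and "path_weight UNIV (line_weight s) (line_measure s) [k..<Suc (k + i)]
           = line_pos s (k + i) - line_pos s k"
proof -
  show "[k..<Suc (k + i)] \<in> graph_paths UNIV (line_weight s) k (k + i)"
    using assms by (auto simp: graph_paths_def successively_conv_nth line_weight_def nth_append hd_append)
  have "path_weight UNIV (line_weight s) (line_measure s) [k..<Suc (k + i)]
      = (\<Sum>j<i. line_step s (k + j))"
    unfolding path_weight_def
    by (rule sum.cong) (auto simp: weighted_degree_line assms line_step_def simp del: upt_Suc)
  also have "\<dots> = line_pos s (k + i) - line_pos s k"
    by (induction i) (auto simp: line_pos_Suc)
  finally show "path_weight UNIV (line_weight s) (line_measure s) [k..<Suc (k + i)]
           = line_pos s (k + i) - line_pos s k" .
qed

lemma line_path_down:
  assumes "\<And>k. s k > 0"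
  shows "rev [k..<Suc (k + i)] \<in> graph_paths UNIV (line_weight s) (k + i) k"
    and "path_weight UNIV (line_weight s) (line_measure s) (rev [k..<Suc (k + i)])
           = line_pos s (k + i) - line_pos s k"
proof -
  show "rev [k..<Suc (k + i)] \<in> graph_paths UNIV (line_weight s) (k + i) k"
    using assms
    by (auto simp: graph_paths_def successively_conv_nth line_weight_def rev_nth hd_rev last_rev
        nth_append nth_Cons split: nat.splits)
  have "path_weight UNIV (line_weight s) (line_measure s) (rev [k..<Suc (k + i)])
      = (\<Sum>j<i. line_step s (k + (i - Suc j)))"
    unfolding path_weight_def
    by (rule sum.cong)
      (auto simp: weighted_degree_line assms line_step_def rev_nth min.commute Suc_diff_Suc
        simp del: upt_Suc)
  also have "\<dots> = (\<Sum>j<i. line_step s (k + j))"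
    by (rule sum.nat_diff_reindex)
  also have "\<dots> = line_pos s (k + i) - line_pos s k"
    by (induction i) (auto simp: line_pos_Suc)
  finally show "path_weight UNIV (line_weight s) (line_measure s) (rev [k..<Suc (k + i)])
           = line_pos s (k + i) - line_pos s k" .
qed

text \<open>The monotone path gives the upper bound. The lower bound holds because
  \<open>line_pos s\<close> changes along each edge by exactly the length of the edge.\<close>

lemma degree_metric_line:
  assumes pos: "\<And>k. s k > 0"
  shows "degree_metric UNIV (line_weight s) (line_measure s) k l = \<bar>line_pos s l - line_pos s k\<bar>"
proof -
  obtain p where p: "p \<in> graph_paths UNIV (line_weight s) k l"
    "path_weight UNIV (line_weight s) (line_measure s) p = \<bar>line_pos s l - line_pos s k\<bar>"
  proof (cases "k \<le> l")
    case True
    then obtain i where i: "l = k + i" using le_Suc_ex by blast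
    show ?thesis
      using that[of "[k..<Suc (k + i)]"] line_path_up[OF pos] monoD[OF mono_line_pos True] i by simp
  next
    case False
    then have le: "l \<le> k" by simp
    then obtain i where i: "k = l + i" using le_Suc_ex by blast
    show ?thesis
      using that[of "rev [l..<Suc (l + i)]"] line_path_down[OF pos] monoD[OF mono_line_pos le] i
      by simp
  qed
  show ?thesis
  proof (rule antisym)
    show "degree_metric UNIV (line_weight s) (line_measure s) k l \<le> \<bar>line_pos s l - line_pos s k\<bar>"
      unfolding p(2)[symmetric]
      by (rule degree_metric_le_path_weight) (use p(1) in \<open>auto simp: line_weight_def line_measure_def\<close>)
    show "\<bar>line_pos s l - line_pos s k\<bar> \<le> degree_metric UNIV (line_weight s) (line_measure s) k l"
    proof (rule degree_metric_ge_Lipschitz)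
      fix u v :: nat
      assume "line_weight s u v > 0"
      then have "v = Suc u \<or> u = Suc v" by (auto simp: line_weight_def split: if_splits)
      then show "\<bar>line_pos s v - line_pos s u\<bar> \<le>
          sqrt (min (1 / weighted_degree UNIV (line_weight s) (line_measure s) u)
                    (1 / weighted_degree UNIV (line_weight s) (line_measure s) v))"
        using line_step_nonneg[of s u] line_step_nonneg[of s v]
        by (auto simp: weighted_degree_line pos line_pos_Suc line_step_def min.commute)
    qed (use p in auto)
  qed
qed

section \<open>The anti-tree\<close>

lemma sphere_index_eq:
  assumes "antitree s S rt" and "x \<in> S k"
  shows "sphere_index S x = k"
  unfolding sphere_index_def
proof (rule the_equality)
  fix j assume "x \<in> S j"
  then show "j = k"
    using assms by (auto simp: antitree_def disjoint_family_on_def)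
qed (use assms in auto)

text \<open>By disjointness \<open>x\<close> lies in no other sphere, so its neighbours fill exactly
  the adjacent spheres, each with weight 1.\<close>

lemma weighted_degree_antitree:
  assumes at: "antitree s S rt" and x: "x \<in> S k"
  shows "weighted_degree (\<Union>k. S k) (antitree_weight S) (\<lambda>_. 1) x = line_degree s k"
proof -
  let ?A = "(if k = 0 then {} else S (k - 1)) \<union> S (k + 1)"
  have fin: "finite (S j)" and card: "card (S j) = s j" for j
    using at by (auto simp: antitree_def)
  have disj: "S i \<inter> S j = {}" if "i \<noteq> j" for i j
    using at that by (auto simp: antitree_def disjoint_family_on_def)
  have idx: "j = k" if "x \<in> S j" for j
    using sphere_index_eq[OF at x] sphere_index_eq[OF at that] by simp
  have w: "antitree_weight S x y = (if y \<in> ?A then 1 else 0)" for y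
  proof -
    have "(\<exists>j. x \<in> S j \<and> y \<in> S (j + 1) \<or> y \<in> S j \<and> x \<in> S (j + 1)) \<longleftrightarrow> y \<in> ?A"
    proof
      assume "\<exists>j. x \<in> S j \<and> y \<in> S (j + 1) \<or> y \<in> S j \<and> x \<in> S (j + 1)"
      then obtain j where "x \<in> S j \<and> y \<in> S (j + 1) \<or> y \<in> S j \<and> x \<in> S (j + 1)" ..
      then show "y \<in> ?A" using idx[of j] idx[of "j + 1"] by auto
    next
      assume "y \<in> ?A"
      then consider "y \<in> S (k + 1)" | "k \<noteq> 0" "y \<in> S (k - 1)" by (auto split: if_splits)
      then show "\<exists>j. x \<in> S j \<and> y \<in> S (j + 1) \<or> y \<in> S j \<and> x \<in> S (j + 1)"
      proof cases
        case 1
        then show ?thesis using x by blast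
      next
        case 2
        then show ?thesis using x by (intro exI[of _ "k - 1"]) simp
      qed
    qed
    then show ?thesis unfolding antitree_weight_def by simp
  qed
  have "(\<Sum>\<^sub>\<infinity>y\<in>(\<Union>k. S k). antitree_weight S x y) = (\<Sum>\<^sub>\<infinity>y\<in>?A. 1)"
    by (rule infsum_cong_neutral) (auto simp: w split: if_splits)
  also have "\<dots> = real (card ?A)"
    using fin by (subst infsum_finite) auto
  also have "\<dots> = line_degree s k"
    using fin card disj by (auto simp: line_degree_def card_Un_disjoint)
  finally show ?thesis by (simp add: weighted_degree_def)
qed

lemma graph_paths_snoc:
  assumes "p \<in> graph_paths X b x y" and "z \<in> X" and "b y z > 0"
  shows "p @ [z] \<in> graph_paths X b x z"
  using assms by (auto simp: graph_paths_def successively_append_iff)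

text \<open>All spheres are nonempty, so a path from the root can climb one sphere at a
  time.\<close>

lemma antitree_connected:
  assumes at: "antitree s S rt" and pos: "\<And>k. s k > 0" and x: "x \<in> S k"
  shows "graph_paths (\<Union>k. S k) (antitree_weight S) rt x \<noteq> {}"
  using x
proof (induction k arbitrary: x)
  case 0
  then have "[x] \<in> graph_paths (\<Union>k. S k) (antitree_weight S) rt x"
    using at by (auto simp: graph_paths_def antitree_def)
  then show ?case by blast
next
  case (Suc k)
  have "card (S k) > 0" using at pos by (simp add: antitree_def)
  then obtain y where y: "y \<in> S k" by fastforce
  then obtain p where p: "p \<in> graph_paths (\<Union>k. S k) (antitree_weight S) rt y"
    using Suc.IH by blast
  have "antitree_weight S y x > 0"
    using y Suc.prems by (auto simp: antitree_weight_def)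
  with graph_paths_snoc[OF p] Suc.prems show ?case by blast
qed

text \<open>Edges join consecutive spheres and have the same length as on the line, so
  \<open>line_pos s\<close> of the sphere index is a valid test function. This turns the radius
  condition in the anti-tree into one on the line.\<close>

lemma line_pos_le_antitree_metric:
  assumes at: "antitree s S rt" and pos: "\<And>k. s k > 0" and x: "x \<in> S k"
  shows "line_pos s k \<le> antitree_metric S rt x"
proof -
  have "\<bar>line_pos s (sphere_index S x) - line_pos s (sphere_index S rt)\<bar> \<le> antitree_metric S rt x"
    unfolding antitree_metric_def
  proof (rule degree_metric_ge_Lipschitz)
    fix u v
    assume "antitree_weight S u v > 0"
    then obtain j where "u \<in> S j \<and> v \<in> S (Suc j) \<or> v \<in> S j \<and> u \<in> S (Suc j)"
      by (auto simp: antitree_weight_def split: if_splits)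
    then show "\<bar>line_pos s (sphere_index S v) - line_pos s (sphere_index S u)\<bar> \<le>
        sqrt (min (1 / weighted_degree (\<Union>k. S k) (antitree_weight S) (\<lambda>_. 1) u)
                  (1 / weighted_degree (\<Union>k. S k) (antitree_weight S) (\<lambda>_. 1) v))"
      using line_step_nonneg[of s j]
      by (auto simp: weighted_degree_antitree[OF at] sphere_index_eq[OF at] line_pos_Suc
          line_step_def min.commute)
  qed (rule antitree_connected[OF at pos x])
  moreover have "rt \<in> S 0" using at by (simp add: antitree_def)
  ultimately show ?thesis
    by (simp add: sphere_index_eq[OF at] sphere_index_eq[OF at x] line_pos_nonneg)
qed


section \<open>Power growth of the spheres\<close>

lemma powr_increment_MVT:
  fixes p x :: real
  assumes "p > 0" and "x \<ge> 0"
  shows "\<exists>z. x < z \<and> z < x + 1 \<and> (x + 1) powr p - x powr p = p * z powr (p - 1)"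
proof -
  have "\<exists>l z. x < z \<and> z < x + 1 \<and> ((\<lambda>u. u powr p) has_real_derivative l) (at z)
          \<and> (x + 1) powr p - x powr p = (x + 1 - x) * l"
  proof (rule MVT)
    show "continuous_on {x..x + 1} (\<lambda>u. u powr p)"
      using assms by (intro continuous_on_powr') (auto intro: continuous_intros)
    \<comment> \<open>Differentiability is asked only inside the interval; this admits
      \<open>x = 0\<close>, where it fails for \<open>p < 1\<close>.\<close>
    fix u assume "x < u" "u < x + 1"
    then show "(\<lambda>u. u powr p) differentiable at u"
      using assms has_real_derivative_powr[of u p] real_differentiable_def by fastforce
  qed simp
  then obtain l z where z: "x < z" "z < x + 1" "((\<lambda>u. u powr p) has_real_derivative l) (at z)"
      "(x + 1) powr p - x powr p = l" by auto
  moreover have "l = p * z powr (p - 1)"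
    using z(1,3) assms has_real_derivative_powr[of z p] DERIV_unique by force
  ultimately show ?thesis by blast
qed

text \<open>Each summand is at most the increment of \<open>u powr p / p\<close> over the unit
  interval to its left, because the derivative \<open>u powr (p - 1)\<close> is nonincreasing; the
  increments telescope.\<close>

lemma sum_powr_le:
  fixes p :: real
  assumes "0 < p" and "p \<le> 1"
  shows "(\<Sum>j<k. real (j + 1) powr (p - 1)) \<le> real k powr p / p"
proof (induction k)
  case (Suc k)
  obtain z where z: "real k < z" "z < real k + 1"
      "(real k + 1) powr p - real k powr p = p * z powr (p - 1)"
    using powr_increment_MVT[of p "real k"] assms by auto
  have "(real k + 1) powr (p - 1) \<le> z powr (p - 1)"
    using z assms by (intro powr_mono2') auto
  also have "\<dots> = (real k + 1) powr p / p - real k powr p / p"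
    using z(3) assms by (simp add: diff_divide_distrib[symmetric])
  finally show ?case using Suc.IH by (simp add: add.commute)
qed simp

text \<open>As before, but now the derivative is nondecreasing, which reverses the
  comparison.\<close>

lemma sum_powr_ge:
  fixes p :: real
  assumes "1 \<le> p"
  shows "real k powr p / p \<le> (\<Sum>j<k. real (j + 1) powr (p - 1))"
proof (induction k)
  case (Suc k)
  obtain z where z: "real k < z" "z < real k + 1"
      "(real k + 1) powr p - real k powr p = p * z powr (p - 1)"
    using powr_increment_MVT[of p "real k"] assms by auto
  have "(real k + 1) powr p / p - real k powr p / p = z powr (p - 1)"
    using z(3) assms by (simp add: diff_divide_distrib[symmetric])
  also have "\<dots> \<le> (real k + 1) powr (p - 1)"
    using z assms by (intro powr_mono2) auto
  finally show ?case using Suc.IH by (simp add: add.commute)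
qed simp

section \<open>Sphere sizes compared with powers\<close>

lemma power_sphere_le: "real (power_sphere \<gamma> k) \<le> real (k + 1) powr \<gamma>"
  unfolding power_sphere_def by (simp add: of_nat_nat)

text \<open>A number that is at least 1 is less than its integer part plus 1, hence at most twice
  its integer part.\<close>

lemma power_sphere_ge:
  assumes "0 \<le> \<gamma>"
  shows "real (k + 1) powr \<gamma> / 2 \<le> real (power_sphere \<gamma> k)" and "power_sphere \<gamma> k > 0"
proof -
  let ?y = "real (k + 1) powr \<gamma>"
  have "1 \<le> ?y" using assms by (intro ge_one_powr_ge_zero) auto
  then have "1 \<le> \<lfloor>?y\<rfloor>" by linarith
  moreover have "?y < of_int \<lfloor>?y\<rfloor> + 1" by linarith
  moreover have "?y / 2 \<le> of_int \<lfloor>?y\<rfloor>" using calculation by linarith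
  ultimately show "?y / 2 \<le> real (power_sphere \<gamma> k)" "power_sphere \<gamma> k > 0"
    unfolding power_sphere_def by auto
qed

lemma power_sphere_mono:
  assumes "0 \<le> \<gamma>" and "j \<le> k"
  shows "power_sphere \<gamma> j \<le> power_sphere \<gamma> k"
  unfolding power_sphere_def using assms by (intro nat_mono floor_mono powr_mono2; simp)

text \<open>For \<open>i \<le> 2\<close> the base grows at most by the factor 3, and
  \<open>3 powr \<gamma> \<le> 9\<close>. Shifts up to 2 occur in the degrees at both ends of the
  edge from \<open>k\<close> to \<open>k + 1\<close>.\<close>

lemma power_sphere_shift_le:
  assumes "0 \<le> \<gamma>" and "\<gamma> < 2" and "i \<le> 2"
  shows "real (power_sphere \<gamma> (k + i)) \<le> 9 * real (k + 1) powr \<gamma>"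
proof -
  have "real (power_sphere \<gamma> (k + i)) \<le> real (k + i + 1) powr \<gamma>"
    by (rule power_sphere_le)
  also have "\<dots> \<le> (3 * real (k + 1)) powr \<gamma>"
    using assms by (intro powr_mono2) auto
  also have "\<dots> = 3 powr \<gamma> * real (k + 1) powr \<gamma>"
    by (rule powr_mult)
  also have "3 powr \<gamma> \<le> (3::real) powr 2"
    using assms by (intro powr_mono) auto
  finally show ?thesis by (simp add: mult_right_mono)
qed

section \<open>Edge lengths and positions on the line\<close>

lemma line_step_power_sphere:
  assumes "0 \<le> \<gamma>" and "\<gamma> < 2"
  shows "real (k + 1) powr (- \<gamma> / 2) / 5 \<le> line_step (power_sphere \<gamma>) k"
    and "line_step (power_sphere \<gamma>) k \<le> 2 * real (k + 1) powr (- \<gamma> / 2)"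
proof -
  let ?s = "power_sphere \<gamma>"
  let ?a = "real (k + 1)"
  have a: "?a powr \<gamma> > 0" by simp
  have sq: "(?a powr (- \<gamma> / 2))\<^sup>2 = 1 / ?a powr \<gamma>"
    by (simp add: power2_eq_square powr_add[symmetric] powr_minus_divide)
  have s1: "real (?s (k - 1)) \<le> 9 * ?a powr \<gamma>"
    using power_sphere_mono[of \<gamma> "k - 1" k] power_sphere_shift_le[of \<gamma> 0 k] assms
    by (simp add: order_trans[OF of_nat_mono])
  have s: "real (?s k) \<le> 9 * ?a powr \<gamma>" "real (?s (k + 1)) \<le> 9 * ?a powr \<gamma>"
     "real (?s (k + 2)) \<le> 9 * ?a powr \<gamma>"
    using power_sphere_shift_le[of \<gamma> 0 k] power_sphere_shift_le[of \<gamma> 1 k]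
      power_sphere_shift_le[of \<gamma> 2 k] assms by simp_all
  \<comment> \<open>One lower bound on a degree suffices for the upper bound on the edge, since a
    minimum is at most its second entry; the degree of \<open>Suc k\<close> counts sphere
    \<open>k\<close>.\<close>
  have lo: "?a powr \<gamma> / 2 \<le> line_degree ?s (Suc k)"
    using power_sphere_ge[of \<gamma> k] assms by (simp add: line_degree_def)
  have pos: "0 < line_degree ?s k"
    using power_sphere_ge(2)[of \<gamma>] assms by (auto simp: line_degree_def add_nonneg_pos)
  have hi: "line_degree ?s k \<le> 18 * ?a powr \<gamma>" "line_degree ?s (Suc k) \<le> 18 * ?a powr \<gamma>"
    using s1 s by (auto simp: line_degree_def)
  \<comment> \<open>Each degree adds up at most two sphere sizes, hence the bound 18; it is enlarged
    to 25 to have an exact square root.\<close>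
  have "1 / (25 * ?a powr \<gamma>) \<le> 1 / line_degree ?s k"
       "1 / (25 * ?a powr \<gamma>) \<le> 1 / line_degree ?s (Suc k)"
    using hi lo pos a by (auto intro!: divide_left_mono mult_pos_pos)
  then show "?a powr (- \<gamma> / 2) / 5 \<le> line_step ?s k"
    unfolding line_step_def
    by (intro real_le_rsqrt) (simp only: power_divide sq min.bounded_iff, simp)
  have "1 / line_degree ?s (Suc k) \<le> 1 / (?a powr \<gamma> / 2)"
    using lo a by (intro divide_left_mono mult_pos_pos) linarith+
  also have "\<dots> \<le> (2 * ?a powr (- \<gamma> / 2))\<^sup>2"
    unfolding power_mult_distrib sq using a by (simp add: divide_right_mono)
  finally show "line_step ?s k \<le> 2 * ?a powr (- \<gamma> / 2)"
    unfolding line_step_def by (intro real_le_lsqrt) auto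
qed

text \<open>From below, each of the \<open>k\<close> edges is at least as long as the bound taken at
  \<open>k\<close>. From above, the edge bounds are summed by \<open>sum_powr_le\<close> with
  \<open>p = 1 - \<gamma> / 2\<close>.\<close>

lemma line_pos_power_sphere:
  assumes "0 \<le> \<gamma>" and "\<gamma> < 2"
  shows "real k powr (1 - \<gamma> / 2) / 5 \<le> line_pos (power_sphere \<gamma>) k"
    and "line_pos (power_sphere \<gamma>) k \<le> 2 / (1 - \<gamma> / 2) * real k powr (1 - \<gamma> / 2)"
proof -
  have "real k powr (1 - \<gamma> / 2) / 5 = (\<Sum>j<k. real k powr (- \<gamma> / 2) / 5)"
    using powr_add[of "real k" 1 "- \<gamma> / 2"] by (cases "k = 0") auto
  also have "\<dots> \<le> (\<Sum>j<k. real (j + 1) powr (- \<gamma> / 2) / 5)"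
    using assms by (intro sum_mono divide_right_mono powr_mono2') auto
  also have "\<dots> \<le> line_pos (power_sphere \<gamma>) k"
    unfolding line_pos_def using assms by (intro sum_mono line_step_power_sphere)
  finally show "real k powr (1 - \<gamma> / 2) / 5 \<le> line_pos (power_sphere \<gamma>) k" .
  have "line_pos (power_sphere \<gamma>) k \<le> (\<Sum>j<k. 2 * real (j + 1) powr (- \<gamma> / 2))"
    unfolding line_pos_def using assms by (intro sum_mono line_step_power_sphere)
  also have "\<dots> = 2 * (\<Sum>j<k. real (j + 1) powr ((1 - \<gamma> / 2) - 1))"
    by (simp add: sum_distrib_left)
  also have "\<dots> \<le> 2 * (real k powr (1 - \<gamma> / 2) / (1 - \<gamma> / 2))"
    using assms by (intro mult_left_mono sum_powr_le) auto
  finally show "line_pos (power_sphere \<gamma>) k \<le> 2 / (1 - \<gamma> / 2) * real k powr (1 - \<gamma> / 2)"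
    by simp
qed

section \<open>Volumes of initial segments, and balls\<close>

lemma vertex_measure_line_le:
  assumes "0 \<le> \<gamma>" and "W \<subseteq> {..k}"
  shows "vertex_measure (line_measure (power_sphere \<gamma>)) W \<le> real (k + 1) powr (\<gamma> + 1)"
proof -
  have fin: "finite W" using assms(2) finite_subset by blast
  have "vertex_measure (line_measure (power_sphere \<gamma>)) W = (\<Sum>j\<in>W. real (power_sphere \<gamma> j))"
    using fin by (simp add: vertex_measure_def line_measure_def)
  also have "\<dots> \<le> (\<Sum>j\<in>{..k}. real (power_sphere \<gamma> j))"
    using assms(2) by (intro sum_mono2) auto
  also have "\<dots> \<le> (\<Sum>j\<in>{..k}. real (k + 1) powr \<gamma>)"
    using assms(1)
    by (intro sum_mono order_trans[OF power_sphere_le] powr_mono2) auto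
  also have "\<dots> = real (k + 1) powr (\<gamma> + 1)"
    by (simp add: powr_add)
  finally show ?thesis .
qed

text \<open>The constant 6 combines \<open>\<gamma> + 1 \<le> 3\<close> from the integral with the
  factor 2 lost to integer parts.\<close>

lemma vertex_measure_line_ge:
  assumes "0 \<le> \<gamma>" and "\<gamma> < 2"
  shows "real (k + 1) powr (\<gamma> + 1) / 6 \<le> vertex_measure (line_measure (power_sphere \<gamma>)) {..k}"
proof -
  have "real (k + 1) powr (\<gamma> + 1) / 6 \<le> real (k + 1) powr (\<gamma> + 1) / (\<gamma> + 1) / 2"
    unfolding divide_divide_eq_left using assms by (intro divide_left_mono) auto
  also have "\<dots> \<le> (\<Sum>j<k + 1. real (j + 1) powr \<gamma>) / 2"
    using sum_powr_ge[of "\<gamma> + 1" "k + 1"] assms by (intro divide_right_mono) auto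
  also have "\<dots> = (\<Sum>j\<le>k. real (j + 1) powr \<gamma> / 2)"
    by (simp add: sum_divide_distrib lessThan_Suc_atMost)
  also have "\<dots> \<le> (\<Sum>j\<le>k. real (power_sphere \<gamma> j))"
    using assms by (intro sum_mono power_sphere_ge)
  also have "\<dots> = vertex_measure (line_measure (power_sphere \<gamma>)) {..k}"
    by (simp add: vertex_measure_def line_measure_def)
  finally show ?thesis .
qed

lemma line_ball_power_sphere:
  assumes "0 \<le> \<gamma>" and "\<gamma> < 2" and "1 \<le> r" and pos: "line_pos (power_sphere \<gamma>) k \<le> r"
  obtains M where "line_ball (power_sphere \<gamma>) r k = {..M}"
    and "real (M + 1) powr (1 - \<gamma> / 2) \<le> 20 * r"
    and "r \<le> 2 / (1 - \<gamma> / 2) * real (M + 1) powr (1 - \<gamma> / 2)"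
proof -
  let ?P = "line_pos (power_sphere \<gamma>)"
  let ?B = "{l. ?P l \<le> ?P k + r}"
  \<comment> \<open>The ball also demands \<open>?P k - r \<le> ?P l\<close>, which is automatic:
    the left side is at most 0 and positions are nonnegative.\<close>
  have B: "line_ball (power_sphere \<gamma>) r k = ?B"
    unfolding line_ball_def degree_ball_def degree_metric_line[OF power_sphere_ge(2)[OF assms(1)]]
    using pos line_pos_nonneg[of "power_sphere \<gamma>"] by (auto simp: abs_le_iff) (smt (verit))
  have \<beta>: "1 - \<gamma> / 2 > 0" using assms by simp
  let ?c = "5 * (?P k + r)"
  \<comment> \<open>Inverting the power in the lower bound for positions shows that the ball is
    bounded.\<close>
  obtain L where L: "?c powr (1 / (1 - \<gamma> / 2)) < real L"
    using reals_Archimedean2 by blast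
  have "l < L" if "l \<in> ?B" for l
  proof -
    have "real l powr (1 - \<gamma> / 2) \<le> ?c"
      using that line_pos_power_sphere(1)[OF assms(1,2), of l] by simp
    then have "(real l powr (1 - \<gamma> / 2)) powr (1 / (1 - \<gamma> / 2)) \<le> ?c powr (1 / (1 - \<gamma> / 2))"
      using \<beta> by (intro powr_mono2) auto
    then have "real l \<le> ?c powr (1 / (1 - \<gamma> / 2))"
      using \<beta> by (simp add: powr_powr)
    then show "l < L" using L by linarith
  qed
  then have fin: "finite ?B" using finite_nat_set_iff_bounded by blast
  have ne: "?B \<noteq> {}" using assms(3) by (auto intro!: exI[of _ k])
  define M where "M = Max ?B"
  have M: "M \<in> ?B" unfolding M_def using fin ne by (rule Max_in)
  have le: "l \<le> M" if "l \<in> ?B" for l unfolding M_def using fin that by simp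
  have eq: "?B = {..M}"
  proof (intro equalityI subsetI)
    fix l assume "l \<in> {..M}"
    then have "?P l \<le> ?P M" by (intro monoD[OF mono_line_pos]) auto
    then show "l \<in> ?B" using M by simp
  qed (use le in auto)
  \<comment> \<open>The position of \<open>M\<close> is at most \<open>2 * r\<close> and the next
    edge has length at most 2, so \<open>?P (M + 1) \<le> 4 * r\<close>; the constant 5 in the lower
    bound for positions then gives 20.\<close>
  have "line_step (power_sphere \<gamma>) M \<le> 2 * real (M + 1) powr (- \<gamma> / 2)"
    by (rule line_step_power_sphere) fact+
  also have "\<dots> \<le> 2 * 1 powr (- \<gamma> / 2)"
    using assms by (intro mult_left_mono powr_mono2') auto
  finally have "?P (M + 1) \<le> 4 * r"
    using M pos assms(3) by (simp add: line_pos_Suc)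
  then have "real (M + 1) powr (1 - \<gamma> / 2) \<le> 20 * r"
    using line_pos_power_sphere(1)[OF assms(1,2), of "M + 1"] by linarith
  \<comment> \<open>By maximality of \<open>M\<close> the vertex \<open>M + 1\<close> lies outside
    the ball.\<close>
  moreover have "?P k + r < ?P (M + 1)"
    using le[of "M + 1"] by force
  then have "r \<le> 2 / (1 - \<gamma> / 2) * real (M + 1) powr (1 - \<gamma> / 2)"
    using line_pos_power_sphere(2)[OF assms(1,2), of "M + 1"] line_pos_nonneg[of "power_sphere \<gamma>" k]
    by linarith
  ultimately show thesis using that B eq by simp
qed

section \<open>The isoperimetric constant\<close>

text \<open>Written exactly as the numerator in \<open>isoperimetric_const\<close>, so that it can
  be folded there.\<close>

definition line_boundary_weight :: "(nat \<Rightarrow> nat) \<Rightarrow> nat set \<Rightarrow> real" where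
  "line_boundary_weight s W =
     (\<Sum>\<^sub>\<infinity>(x, y)\<in>edge_boundary UNIV (line_weight s) W.
        line_weight s x y * degree_metric UNIV (line_weight s) (line_measure s) x y)"

lemma line_boundary_weight_ge:
  assumes pos: "\<And>k. s k > 0" and "finite W" and "k \<in> W" and "Suc k \<notin> W"
  shows "real (s k) * real (s (Suc k)) * line_step s k \<le> line_boundary_weight s W"
proof -
  let ?f = "\<lambda>(x, y). line_weight s x y * degree_metric UNIV (line_weight s) (line_measure s) x y"
  let ?E = "edge_boundary UNIV (line_weight s) W"
  \<comment> \<open>Finiteness of the boundary makes the infinite sum an ordinary one instead of a
    possible default value 0, so a single edge bounds it from below.\<close>
  have "?E \<subseteq> {..Suc (Max W)} \<times> {..Suc (Max W)}"
    using Max_ge[OF assms(2)]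
    by (fastforce simp: edge_boundary_def line_weight_def split: if_splits)
  then have fin: "finite ?E" by (rule finite_subset) auto
  have "real (s k) * real (s (Suc k)) * line_step s k = ?f (k, Suc k)"
    using line_step_nonneg[of s k]
    by (simp add: line_weight_def degree_metric_line[OF pos] line_pos_Suc)
  also have "\<dots> \<le> (\<Sum>e\<in>?E. ?f e)"
    using assms fin
    by (intro member_le_sum)
      (auto simp: edge_boundary_def line_weight_def degree_metric_line[OF pos])
  finally show ?thesis
    using fin by (simp add: line_boundary_weight_def)
qed

text \<open>The factor 2 counts the only boundary edge in both orientations.\<close>

lemma line_boundary_weight_atMost:
  assumes pos: "\<And>k. s k > 0"
  shows "line_boundary_weight s {..k} = 2 * (real (s k) * real (s (Suc k)) * line_step s k)"
proof -
  have E: "edge_boundary UNIV (line_weight s) {..k} = {(k, Suc k), (Suc k, k)}"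
    using pos by (auto simp: edge_boundary_def line_weight_def split: if_splits)
  show ?thesis
    unfolding line_boundary_weight_def E
    using line_step_nonneg[of s k]
    by (simp add: line_weight_def degree_metric_line[OF pos] line_pos_Suc)
qed

lemma line_boundary_weight_nonneg:
  assumes pos: "\<And>k. s k > 0"
  shows "0 \<le> line_boundary_weight s W"
  unfolding line_boundary_weight_def
  by (intro infsum_nonneg) (auto simp: line_weight_def degree_metric_line[OF pos])

lemma line_isoperimetric_const_ge:
  assumes "B \<noteq> {}"
    and "\<And>W. W \<noteq> {} \<Longrightarrow> W \<subseteq> B \<Longrightarrow>
      c \<le> line_boundary_weight s W / vertex_measure (line_measure s) W powr ((n - 2) / n)"
  shows "c \<le> line_isoperimetric_const s n B"
  unfolding line_isoperimetric_const_def isoperimetric_const_def line_boundary_weight_def[symmetric]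
  by (rule cINF_greatest) (use assms in auto)

lemma line_isoperimetric_const_le:
  assumes "\<And>k. s k > 0" and "W \<noteq> {}" and "W \<subseteq> B"
  shows "line_isoperimetric_const s n B
    \<le> line_boundary_weight s W / vertex_measure (line_measure s) W powr ((n - 2) / n)"
  unfolding line_isoperimetric_const_def isoperimetric_const_def line_boundary_weight_def[symmetric]
  by (rule cINF_lower)
    (use assms line_boundary_weight_nonneg[of s] in \<open>auto intro!: bdd_belowI2[where m = 0]\<close>)

section \<open>Two-sided bounds on initial segments\<close>

lemma line_isoperimetric_const_atMost_le:
  assumes "0 \<le> \<gamma>" and "\<gamma> < 2"
  shows "line_isoperimetric_const (power_sphere \<gamma>) n {..k}
    \<le> 36 * real (k + 1) powr (3 * \<gamma> / 2)
        / vertex_measure (line_measure (power_sphere \<gamma>)) {..k} powr ((n - 2) / n)"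
proof -
  let ?s = "power_sphere \<gamma>"
  let ?a = "real (k + 1)"
  note pos = power_sphere_ge(2)[OF assms(1)]
  have "line_boundary_weight ?s {..k} = 2 * (real (?s k) * real (?s (Suc k)) * line_step ?s k)"
    by (rule line_boundary_weight_atMost[OF pos])
  \<comment> \<open>Sphere sizes contribute \<open>\<gamma>\<close> twice and the edge length
    \<open>- \<gamma> / 2\<close>; the constant will be \<open>2 * 9 * 2 = 36\<close>.\<close>
  also have "\<dots> \<le> 2 * (?a powr \<gamma> * (9 * ?a powr \<gamma>) * (2 * ?a powr (- \<gamma> / 2)))"
    using power_sphere_le[of \<gamma> k] power_sphere_shift_le[OF assms, of 1 k]
      line_step_power_sphere(2)[OF assms, of k] line_step_nonneg[of ?s k]
    by (intro mult_mono mult_left_mono) auto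
  also have "\<dots> = 36 * ?a powr (\<gamma> + \<gamma> + (- \<gamma> / 2))"
    by (simp only: powr_add)
  also have "\<gamma> + \<gamma> + (- \<gamma> / 2) = 3 * \<gamma> / 2" by simp
  finally have "line_boundary_weight ?s {..k} \<le> 36 * ?a powr (3 * \<gamma> / 2)" .
  then show ?thesis
    by (intro order_trans[OF line_isoperimetric_const_le[OF pos, of "{..k}"]] divide_right_mono) auto
qed

lemma line_isoperimetric_const_atMost_ge:
  assumes "0 \<le> \<gamma>" and "\<gamma> < 2" and "n \<ge> 2" and exponent: "2 * (\<gamma> + 1) / n \<le> 1 - \<gamma> / 2"
  shows "real (M + 1) powr (2 * (\<gamma> + 1) / n - (1 - \<gamma> / 2)) / 20
    \<le> line_isoperimetric_const (power_sphere \<gamma>) n {..M}"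
proof (rule line_isoperimetric_const_ge)
  let ?s = "power_sphere \<gamma>"
  let ?e = "2 * (\<gamma> + 1) / n - (1 - \<gamma> / 2)"
  note pos = power_sphere_ge(2)[OF assms(1)]
  fix W assume W: "W \<noteq> {}" "W \<subseteq> {..M}"
  then have fin: "finite W" using finite_subset by blast
  \<comment> \<open>The maximum provides both a boundary edge leaving \<open>W\<close> and a segment
    \<open>{..k}\<close> that contains \<open>W\<close>.\<close>
  define k where "k = Max W"
  let ?a = "real (k + 1)"
  have kW: "k \<in> W" and W_le: "W \<subseteq> {..k}" and "Suc k \<notin> W"
    unfolding k_def using fin W by (auto dest: Max_ge)
  have kM: "k \<le> M" using kW W by auto
  have "0 < (\<Sum>j\<in>W. real (?s j))"
    using fin W pos by (intro sum_pos) auto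
  then have vpos: "vertex_measure (line_measure ?s) W > 0"
    using fin by (simp add: vertex_measure_def line_measure_def)
  have "?a powr (3 * \<gamma> / 2) / 20 = ?a powr (\<gamma> + \<gamma> + (- \<gamma> / 2)) / 20"
    by simp
  also have "\<dots> = (?a powr \<gamma> / 2) * (?a powr \<gamma> / 2) * (?a powr (- \<gamma> / 2) / 5)"
    by (simp only: powr_add)
  also have "\<dots> \<le> real (?s k) * real (?s (Suc k)) * line_step ?s k"
  proof (intro mult_mono)
    show "?a powr \<gamma> / 2 \<le> real (?s (Suc k))"
      using power_sphere_ge(1)[OF assms(1), of k] power_sphere_mono[OF assms(1), of k "Suc k"] by simp
  qed (use power_sphere_ge(1)[OF assms(1)] line_step_power_sphere(1)[OF assms(1,2)] in auto)
  also have "\<dots> \<le> line_boundary_weight ?s W"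
    by (rule line_boundary_weight_ge[OF pos]) fact+
  finally have num: "?a powr (3 * \<gamma> / 2) / 20 \<le> line_boundary_weight ?s W" .
  \<comment> \<open>Here \<open>n \<ge> 2\<close> makes the outer exponent nonnegative, so the
    volume bound passes through the power.\<close>
  have "vertex_measure (line_measure ?s) W powr ((n - 2) / n)
      \<le> (?a powr (\<gamma> + 1)) powr ((n - 2) / n)"
    using vertex_measure_line_le[OF assms(1) W_le] vpos assms(3) by (intro powr_mono2) auto
  also have "\<dots> = ?a powr (3 * \<gamma> / 2 - ?e)"
  proof -
    have "(\<gamma> + 1) * ((n - 2) / n) = 3 * \<gamma> / 2 - ?e"
      using assms(3) by (simp add: field_simps)
    then show ?thesis by (simp add: powr_powr)
  qed
  finally have den: "vertex_measure (line_measure ?s) W powr ((n - 2) / n) \<le> ?a powr (3 * \<gamma> / 2 - ?e)" .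
  \<comment> \<open>The exponent \<open>?e\<close> is nonpositive, so passing from \<open>k\<close>
    to the larger \<open>M\<close> can only decrease the bound.\<close>
  have "real (M + 1) powr ?e / 20 \<le> ?a powr ?e / 20"
    using kM exponent by (intro divide_right_mono powr_mono2') auto
  also have "?a powr ?e = ?a powr (3 * \<gamma> / 2) / ?a powr (3 * \<gamma> / 2 - ?e)"
    unfolding powr_diff[symmetric] by (simp add: algebra_simps)
  also have "\<dots> / 20 = (?a powr (3 * \<gamma> / 2) / 20) / ?a powr (3 * \<gamma> / 2 - ?e)"
    by simp
  also have "\<dots> \<le> line_boundary_weight ?s W / vertex_measure (line_measure ?s) W powr ((n - 2) / n)"
    using num den vpos line_boundary_weight_nonneg[OF pos] by (intro frac_le) auto
  finally show "real (M + 1) powr ?e / 20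
      \<le> line_boundary_weight ?s W / vertex_measure (line_measure ?s) W powr ((n - 2) / n)" .
qed auto

section \<open>Comparison on the balls\<close>

theorem lemma4p6:
  fixes \<gamma> d n :: real and s :: "nat \<Rightarrow> nat" and S :: "nat \<Rightarrow> 'a set" and rt :: 'a
  assumes "0 \<le> \<gamma>" and "\<gamma> < 2"
    and "d = 2 * (\<gamma> + 1) / (2 - \<gamma>)"
    and "n \<ge> 2 * d"
    and "s = power_sphere \<gamma>"
    and "antitree s S rt"
  shows "\<exists>C>0. \<forall>x\<in>(\<Union>k. S k). \<forall>r\<ge>max 1 (antitree_metric S rt x).
    (let B = line_ball s r (sphere_index S x);
         h = line_isoperimetric_const s n B;
         g = vertex_measure (line_measure s) B powr (2 / n) / r
     in inverse C * h \<le> g \<and> g \<le> C * h)"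
proof -
  note \<gamma> = assms(1,2)
  note pos = power_sphere_ge(2)[OF assms(1)]
  define \<beta> where "\<beta> = 1 - \<gamma> / 2"
  have \<beta>: "0 < \<beta>" "\<beta> \<le> 1" using \<gamma> by (auto simp: \<beta>_def)
  have n4: "4 * (\<gamma> + 1) / (2 - \<gamma>) \<le> n" using assms(3,4) by simp
  have "2 \<le> 4 * (\<gamma> + 1) / (2 - \<gamma>)" using \<gamma> by (simp add: field_simps)
  with n4 have n: "2 \<le> n" by simp
  \<comment> \<open>This is \<open>n \<ge> 2 * d\<close> rearranged.\<close>
  have exponent: "2 * (\<gamma> + 1) / n \<le> 1 - \<gamma> / 2"
    using n4 n \<gamma> by (simp add: field_simps)
  \<comment> \<open>The upper bound for \<open>h\<close> costs
    \<open>36 * (2 / \<beta>) * 6\<close>. The lower bound costs \<open>20 * 20 = 400\<close>, which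
    is covered because \<open>\<beta> \<le> 1\<close>.\<close>
  define C where "C = 432 / \<beta>"
  have C: "C > 0" "400 \<le> C" using \<beta> by (auto simp: C_def field_simps)
  show ?thesis
  proof (intro exI[of _ C] conjI ballI allI impI)
    fix x r
    assume "x \<in> (\<Union>k. S k)" and r: "max 1 (antitree_metric S rt x) \<le> r"
    then obtain k where x: "x \<in> S k" by blast
    have idx: "sphere_index S x = k" by (rule sphere_index_eq[OF assms(6) x])
    \<comment> \<open>Only here does the radius being at least the distance from the root
      enter.\<close>
    have "line_pos (power_sphere \<gamma>) k \<le> r"
      using line_pos_le_antitree_metric[OF assms(6) _ x] pos r assms(5) by simp
    then obtain M where M: "line_ball (power_sphere \<gamma>) r k = {..M}"
      "real (M + 1) powr \<beta> \<le> 20 * r" "r \<le> 2 / \<beta> * real (M + 1) powr \<beta>"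
      using line_ball_power_sphere[OF \<gamma>, of r k] r unfolding \<beta>_def by auto
    let ?A = "real (M + 1)"
    define V where "V = vertex_measure (line_measure (power_sphere \<gamma>)) {..M}"
    define h where "h = line_isoperimetric_const (power_sphere \<gamma>) n {..M}"
    have V: "?A powr (\<gamma> + 1) / 6 \<le> V" "V \<le> ?A powr (\<gamma> + 1)"
      unfolding V_def using vertex_measure_line_ge[OF \<gamma>] vertex_measure_line_le[OF assms(1)] by auto
    have "0 < ?A powr (\<gamma> + 1) / 6" by simp
    then have Vpos: "V > 0" using V(1) by linarith
    have rpos: "r > 0" using r by simp
    \<comment> \<open>Dividing the volume by the denominator of the isoperimetric ratio leaves the
      power \<open>2 / n\<close>.\<close>
    have Vsplit: "V powr (2 / n) * V powr ((n - 2) / n) = V"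
    proof -
      have "2 / n + (n - 2) / n = 1" using n by (simp add: field_simps)
      then show ?thesis using Vpos by (simp add: powr_add[symmetric])
    qed
    have "h * r \<le> 36 * ?A powr (3 * \<gamma> / 2) / V powr ((n - 2) / n) * (2 / \<beta> * ?A powr \<beta>)"
      unfolding h_def V_def
      using line_isoperimetric_const_atMost_le[OF \<gamma>] M(3) rpos by (intro mult_mono) auto
    also have "\<dots> = C * (?A powr (3 * \<gamma> / 2 + \<beta>) / 6) / V powr ((n - 2) / n)"
      by (simp add: C_def powr_add mult.commute)
    \<comment> \<open>Boundary weight times radius thus has the order of the volume.\<close>
    also have "3 * \<gamma> / 2 + \<beta> = \<gamma> + 1" by (simp add: \<beta>_def)
    also have "C * (?A powr (\<gamma> + 1) / 6) / V powr ((n - 2) / n) \<le> C * V / V powr ((n - 2) / n)"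
      using V(1) C by (intro divide_right_mono mult_left_mono) auto
    also have "\<dots> = C * V powr (2 / n)"
      using Vsplit Vpos by (simp add: divide_eq_eq mult.assoc)
    finally have 1: "inverse C * h \<le> V powr (2 / n) / r"
      using C rpos by (simp add: field_simps)
    \<comment> \<open>For the other inequality, volume over radius is reduced to the same power of
      \<open>M + 1\<close> as in the lower bound for \<open>h\<close>.\<close>
    have "V powr (2 / n) \<le> (?A powr (\<gamma> + 1)) powr (2 / n)"
      using V Vpos n by (intro powr_mono2) auto
    also have "\<dots> = ?A powr (2 * (\<gamma> + 1) / n)"
      by (simp add: powr_powr algebra_simps)
    finally have "V powr (2 / n) / r \<le> ?A powr (2 * (\<gamma> + 1) / n) / (?A powr \<beta> / 20)"
      using M(2) by (intro frac_le) auto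
    also have "\<dots> = 400 * (?A powr (2 * (\<gamma> + 1) / n - (1 - \<gamma> / 2)) / 20)"
      unfolding \<beta>_def[symmetric] by (simp add: powr_diff)
    also have "\<dots> \<le> 400 * h"
      unfolding h_def
      using line_isoperimetric_const_atMost_ge[OF \<gamma> n exponent] by (intro mult_left_mono) auto
    also have "\<dots> \<le> C * h"
    proof (intro mult_right_mono C)
      show "0 \<le> h"
        unfolding h_def
        by (rule order_trans[OF _ line_isoperimetric_const_atMost_ge[OF \<gamma> n exponent]]) simp
    qed
    finally have 2: "V powr (2 / n) / r \<le> C * h" .
    show "let B = line_ball s r (sphere_index S x);
         h = line_isoperimetric_const s n B;
         g = vertex_measure (line_measure s) B powr (2 / n) / r
     in inverse C * h \<le> g \<and> g \<le> C * h"
      using 1 2 by (simp add: assms(5) idx M(1) h_def V_def)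
  qed (rule C)
qed

end
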